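(* Let $T\ge1$ be an integer, $\tau_p>0$, $\delta>0$ and $0<v_{\min}<v_{\max}$. Let $v_0$ be a random variable uniformly distributed on $[v_{\min},v_{\max}]$, and let $l$ be a positive random variable with finite expectation, independent of $v_0$. Suppose that, conditionally on a user's current position and velocity, the probability of mis-prediction during $T$ service times of duration $\tau_p$ is $$\frac{v_0\,T\,\tau_p}{l}.$$ If the expected value of this mis-prediction probability is at most $\delta$, i.e. $\mathbb{E}\left[\frac{v_0T\tau_p}{l}\right]\le\delta$, then $$\tau_p\le \frac{\delta}{T}\,\frac{\ln(v_{\max}/v_{\min})}{v_{\max}-v_{\min}}\,\mathbb{E}[l].$$
   Context: Setting: a user moves in a bounded room according to the random waypoint model, moving in a straight line at constant speed $v_0$ to a randomly chosen stop point, where it pauses before choosing a new one. Time is divided into service times of length $\tau_p$. The user's position over the next $T$ service times is predicted by linear extrapolation, and a mis-prediction occurs if the user stops or changes direction before $T$ service times have elapsed. The random variable $l=l(\theta_0,\vec y^{\,0})$ is the travel length available to the user, a function of the current direction of movement $\theta_0$ and position $\vec y^{\,0}$. Along the current direction the stop point is taken to be uniformly distributed over this length, which gives the mis-prediction probability $v_0T\tau_p/l$. *)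

theory Defs
  imports "HOL-Probability.Probability"
begin

text \<open>Conditional probability of the event \<open>A\<close> given the random variable \<open>X\<close> (with values in \<open>N\<close>):
  the conditional expectation of the indicator of \<open>A\<close> on the sigma-algebra generated by \<open>X\<close>.
  It is determined up to null sets.\<close>

definition cond_prob_given :: "'w measure \<Rightarrow> ('w \<Rightarrow> 'b) \<Rightarrow> 'b measure \<Rightarrow> 'w set \<Rightarrow> 'w \<Rightarrow> real" where
  "cond_prob_given M X N A = real_cond_exp M (vimage_algebra (space M) X N) (indicator A)"

text \<open>The random variable \<open>s\<close> is the time, counted from now, at which the user first stops or
  changes direction.  Linear extrapolation over \<open>T\<close> service times of length \<open>\<tau>p\<close> fails
  iff this happens before they have elapsed.\<close>

definition misprediction :: "'w measure \<Rightarrow> ('w \<Rightarrow> real) \<Rightarrow> nat \<Rightarrow> real \<Rightarrow> 'w set" where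
  "misprediction M s T \<tau>p = {\<omega> \<in> space M. s \<omega> < real T * \<tau>p}"

end

theory Submission
  imports Defs
begin

text \<open>Independence is applied to \<open>1/v0\<close> and \<open>l\<close> rather than to \<open>v0\<close> and \<open>1/l\<close>: then
  \<open>E[l/v0] = E[1/v0] E[l]\<close>, where \<open>E[1/v0] = ln (v_max/v_min) / (v_max - v_min)\<close>, and Jensen's inequality
  \<open>1 \<le> E[v0/l] E[l/v0]\<close> yields the bound.  The Bochner integral of a non-integrable function is 0,
  so integrability of \<open>v0/l\<close> is needed; it holds because, up to a constant,
  \<open>v0/l\<close> is a conditional probability.\<close>

text \<open>Jensen for the convex function \<open>1 / x\<close>, reduced to integrating a pointwise
  bound: \<open>2 * c - c\<^sup>2 * x\<close> is its tangent line at \<open>x = 1 / c\<close>, and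
  \<open>1 / c\<close> is taken to be the mean of \<open>X\<close>.\<close>

lemma (in prob_space) expectation_inverse_ge:
  fixes X :: "'a \<Rightarrow> real"
  assumes X: "integrable M X" and invX: "integrable M (\<lambda>\<omega>. 1 / X \<omega>)"
    and pos: "AE \<omega> in M. X \<omega> > 0"
  shows "expectation X > 0" and "1 \<le> expectation X * expectation (\<lambda>\<omega>. 1 / X \<omega>)"
proof -
  show EX: "expectation X > 0"
  proof -
    have "expectation X > expectation (\<lambda>_. 0)"
      using X pos emeasure_space_1 by (intro integral_less_AE_space) auto
    then show ?thesis by simp
  qed
  define c where "c = 1 / expectation X"
  have c: "c > 0" using EX by (simp add: c_def)
  \<comment> \<open>AM-GM with the weight \<open>c\<close> that makes the integrated inequality sharp.\<close>
  have "AE \<omega> in M. 2 * c \<le> c\<^sup>2 * X \<omega> + 1 / X \<omega>"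
    using pos
  proof eventually_elim
    case (elim \<omega>)
    have "0 \<le> (c * X \<omega> - 1)\<^sup>2 / X \<omega>" using elim by simp
    also have "\<dots> = c\<^sup>2 * X \<omega> + 1 / X \<omega> - 2 * c"
      using elim by (simp add: field_simps power2_eq_square)
    finally show ?case by simp
  qed
  then have "expectation (\<lambda>_. 2 * c) \<le> expectation (\<lambda>\<omega>. c\<^sup>2 * X \<omega> + 1 / X \<omega>)"
    using X invX by (intro integral_mono_AE) auto
  also have "\<dots> = c\<^sup>2 * expectation X + expectation (\<lambda>\<omega>. 1 / X \<omega>)"
    using X invX by simp
  finally have "c \<le> expectation (\<lambda>\<omega>. 1 / X \<omega>)"
    using EX by (simp add: c_def power2_eq_square prob_space)
  then show "1 \<le> expectation X * expectation (\<lambda>\<omega>. 1 / X \<omega>)"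
    using EX by (simp add: c_def field_simps)
qed

text \<open>Bridge to a real-valued density, the form that the change-of-variables rule for Bochner
  integrals takes. Since \<open>a < b\<close>, the length is nonzero, so real division agrees with
  the extended one in \<open>uniform_measure\<close>.\<close>

lemma distributed_uniform_interval:
  fixes a b :: real
  assumes "a < b" and "X \<in> borel_measurable M"
    and "distr M lborel X = uniform_measure lborel {a..b}"
  shows "distributed M lborel X (\<lambda>x. indicator {a..b} x / measure lborel {a..b})"
  unfolding distributed_def
proof (intro conjI)
  have "ennreal (indicator {a..b} x / measure lborel {a..b})
      = indicator {a..b} x / emeasure lborel {a..b}" for x
    using assms(1) by (simp add: divide_ennreal[symmetric] ennreal_indicator)
  then show "distr M lborel X = density lborel (\<lambda>x. ennreal (indicator {a..b} x / measure lborel {a..b}))"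
    using assms(3) by (simp add: uniform_measure_def)
qed (use assms(2) in auto)

text \<open>Transfer to the density leaves the integral of \<open>1 / x\<close> over an interval
  that avoids 0; its antiderivative is the logarithm.\<close>

lemma expectation_inverse_uniform:
  fixes a b :: real
  assumes "0 < a" and "a < b"
    and D: "distributed M lborel X (\<lambda>x. indicator {a..b} x / measure lborel {a..b})"
  shows "(LINT \<omega>|M. 1 / X \<omega>) = ln (b / a) / (b - a)"
proof -
  have "(LINT \<omega>|M. 1 / X \<omega>)
      = (LINT x|lborel. indicator {a..b} x / measure lborel {a..b} * (1 / x))"
    by (rule distributed_integral[OF D, symmetric]) auto
  also have "\<dots> = (LINT x|lborel. 1 / ((b - a) * x) * indicator {a..b} x)"
    using assms by (intro Bochner_Integration.integral_cong) auto
  also have "\<dots> = ln b / (b - a) - ln a / (b - a)"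
  proof (rule integral_FTC_Icc_real)
    fix x :: real assume x: "a \<le> x" "x \<le> b"
    with assms have "0 < x" by simp
    then show "DERIV (\<lambda>x. ln x / (b - a)) x :> 1 / ((b - a) * x)"
      using DERIV_cdivide[OF DERIV_ln_divide, of x "b - a"] by (simp add: mult.commute)
    show "isCont (\<lambda>x. 1 / ((b - a) * x)) x"
      using \<open>0 < x\<close> assms by (auto intro!: continuous_intros)
  qed (use assms in auto)
  also have "\<dots> = ln (b / a) / (b - a)"
    using assms by (simp add: ln_div diff_divide_distrib)
  finally show ?thesis .
qed

lemma (in prob_space) integrable_cond_prob_given:
  assumes "X \<in> M \<rightarrow>\<^sub>M N" and "A \<in> sets M"
  shows "integrable M (cond_prob_given M X N A)"
proof -
  \<comment> \<open>Measurability of \<open>X\<close> says precisely that the sigma-algebra it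
    generates is contained in that of \<open>M\<close>.\<close>
  interpret finite_measure_subalgebra M "vimage_algebra (space M) X N"
    using assms(1) by unfold_locales (simp add: subalgebra_def measurable_iff_sets)
  have "integrable M (indicator A :: _ \<Rightarrow> real)"
    using assms(2) by (simp add: integrable_indicator_iff less_top[symmetric])
  then show ?thesis
    unfolding cond_prob_given_def by (rule real_cond_exp_int)
qed

lemma misprediction_sets:
  "s \<in> borel_measurable M \<Longrightarrow> misprediction M s T \<tau>p \<in> sets M"
  unfolding misprediction_def by measurable

theorem mainTheorem3:
  fixes M :: "'w measure"
    and T :: nat
    and \<tau>p \<delta> v_min v_max :: real
    and v0 \<theta>0 s l :: "'w \<Rightarrow> real"
    and y0 :: "'w \<Rightarrow> real ^ 2"
    and L :: "real \<Rightarrow> real ^ 2 \<Rightarrow> real"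
  assumes "prob_space M"
    and "T \<ge> 1" and "\<tau>p > 0" and "\<delta> > 0"
    and "0 < v_min" and "v_min < v_max"
    and "v0 \<in> borel_measurable M" and "\<theta>0 \<in> borel_measurable M"
    and "y0 \<in> borel_measurable M" and "s \<in> borel_measurable M"
    and v0_uniform: "distr M lborel v0 = uniform_measure lborel {v_min..v_max}"
    and l_travel: "\<And>\<omega>. \<omega> \<in> space M \<Longrightarrow> l \<omega> = L (\<theta>0 \<omega>) (y0 \<omega>)"
    and l_pos: "AE \<omega> in M. l \<omega> > 0"
    and l_integrable: "integrable M l"
    and indep: "prob_space.indep_var M borel v0 borel l"
    and mispred_prob:
      "AE \<omega> in M. cond_prob_given M (\<lambda>\<omega>. (y0 \<omega>, v0 \<omega>, \<theta>0 \<omega>)) borel (misprediction M s T \<tau>p) \<omega>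
         = v0 \<omega> * real T * \<tau>p / l \<omega>"
    and mispred_bound: "(LINT \<omega>|M. v0 \<omega> * real T * \<tau>p / l \<omega>) \<le> \<delta>"
  shows "\<tau>p \<le> \<delta> / real T * (ln (v_max / v_min) / (v_max - v_min)) * (LINT \<omega>|M. l \<omega>)"
proof -
  interpret prob_space M by fact
  note [measurable] = \<open>v0 \<in> borel_measurable M\<close> \<open>\<theta>0 \<in> borel_measurable M\<close> \<open>y0 \<in> borel_measurable M\<close>
  have [measurable]: "l \<in> borel_measurable M" using l_integrable by auto
  define k where "k = real T * \<tau>p"
  have k: "k > 0" using \<open>T \<ge> 1\<close> \<open>\<tau>p > 0\<close> by (simp add: k_def)

  \<comment> \<open>The law of \<open>v0\<close> fixes its range only up to a null set.\<close>
  have v0_range: "AE \<omega> in M. v_min \<le> v0 \<omega> \<and> v0 \<omega> \<le> v_max"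
  proof -
    have "AE x in distr M lborel v0. v_min \<le> x \<and> x \<le> v_max"
      unfolding v0_uniform by (rule AE_uniform_measureI) auto
    then show ?thesis by (subst (asm) AE_distr_iff) auto
  qed
  have pos: "AE \<omega> in M. v0 \<omega> / l \<omega> > 0"
    using v0_range l_pos by eventually_elim (use \<open>0 < v_min\<close> in auto)

  \<comment> \<open>The quotient agrees almost everywhere with a conditional probability and
    inherits its integrability.\<close>
  have "integrable M (\<lambda>\<omega>. v0 \<omega> * real T * \<tau>p / l \<omega>)"
  proof (rule integrable_cong_AE_imp)
    show "integrable M (cond_prob_given M (\<lambda>\<omega>. (y0 \<omega>, v0 \<omega>, \<theta>0 \<omega>)) borel (misprediction M s T \<tau>p))"
      by (intro integrable_cond_prob_given misprediction_sets \<open>s \<in> borel_measurable M\<close>) measurable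
  qed (use mispred_prob in auto)
  then have "integrable M (\<lambda>\<omega>. k * (v0 \<omega> / l \<omega>))"
    by (simp add: k_def mult_ac)
  then have int: "integrable M (\<lambda>\<omega>. v0 \<omega> / l \<omega>)"
    unfolding integrable_mult_left_iff using k by simp
  have le: "k * expectation (\<lambda>\<omega>. v0 \<omega> / l \<omega>) \<le> \<delta>"
    using mispred_bound by (simp add: k_def mult_ac flip: integral_mult_right_zero)

  \<comment> \<open>\<open>v0\<close> stays above \<open>v_min > 0\<close>, so its inverse is
    bounded.\<close>
  have int_inv: "integrable M (\<lambda>\<omega>. 1 / v0 \<omega>)"
  proof (rule integrable_const_bound[where B = "1 / v_min"])
    show "AE \<omega> in M. norm (1 / v0 \<omega>) \<le> 1 / v_min"
      using v0_range by eventually_elim (use \<open>0 < v_min\<close> in \<open>auto simp: field_simps\<close>)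
  qed measurable
  have "indep_var borel ((\<lambda>x. 1 / x) \<circ> v0) borel ((\<lambda>x. x) \<circ> l)"
    by (rule indep_var_compose[OF indep]) measurable
  then have ind: "indep_var borel (\<lambda>\<omega>. 1 / v0 \<omega>) borel l"
    by (simp add: comp_def)
  have int_prod: "integrable M (\<lambda>\<omega>. 1 / v0 \<omega> * l \<omega>)"
    by (rule indep_var_integrable[OF ind int_inv l_integrable])
  define c where "c = ln (v_max / v_min) / (v_max - v_min) * expectation l"
  \<comment> \<open>\<open>1 / (v0 / l)\<close> equals \<open>1 / v0 * l\<close> everywhere, also
    where a denominator is 0, because \<open>x / 0 = 0\<close>. The expectation then factors by
    independence.\<close>
  have E_inv: "expectation (\<lambda>\<omega>. 1 / (v0 \<omega> / l \<omega>)) = c"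
    using indep_var_lebesgue_integral[OF ind int_inv l_integrable]
      expectation_inverse_uniform[OF \<open>0 < v_min\<close> \<open>v_min < v_max\<close>
        distributed_uniform_interval[OF \<open>v_min < v_max\<close> \<open>v0 \<in> borel_measurable M\<close> v0_uniform]]
    by (simp add: c_def)

  have "integrable M (\<lambda>\<omega>. 1 / (v0 \<omega> / l \<omega>))" using int_prod by simp
  from expectation_inverse_ge[OF int this pos]
  have E: "expectation (\<lambda>\<omega>. v0 \<omega> / l \<omega>) > 0" "1 \<le> expectation (\<lambda>\<omega>. v0 \<omega> / l \<omega>) * c"
    unfolding E_inv by auto
  \<comment> \<open>A nonpositive \<open>c\<close> would make the product with the positive
    expectation nonpositive, not at least 1. The sign allows \<open>le\<close> to be multiplied by
    \<open>c\<close> below.\<close>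
  then have "c > 0"
    by (smt (verit) mult_nonneg_nonpos)
  have "k \<le> k * (expectation (\<lambda>\<omega>. v0 \<omega> / l \<omega>) * c)"
    using E(2) k by simp
  also have "\<dots> \<le> \<delta> * c"
    using le \<open>c > 0\<close> by (simp add: mult_right_mono flip: mult.assoc)
  finally have "\<tau>p \<le> \<delta> * c / real T"
    using \<open>T \<ge> 1\<close> by (simp add: k_def field_simps)
  then show ?thesis
    by (simp add: c_def mult_ac)
qed

end
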